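(* Let $m,n,\ell\in\mathbb{N}=\{1,2,\dotsc\}$, let $\theta_k\in(0,1)$ for $1\le k\le\ell$ satisfy $\sum_{k=1}^{\ell}\theta_k=1$, let $y_1,\dotsc,y_\ell>0$, and let $\lambda=(\lambda_{ij})_{1\le i\le m,\,1\le j\le n}$ be a matrix with $\lambda_{ij}>0$ for all $1\le i\le m$ and $1\le j\le n$. Then $$ \begin{aligned} &\frac{\prod_{i=1}^{m}\mathrm{B}\bigl(\lambda_{i1}\sum_{k=1}^{\ell}\theta_ky_k,\ \lambda_{i2}\sum_{k=1}^{\ell}\theta_ky_k,\ \dotsc,\ \lambda_{in}\sum_{k=1}^{\ell}\theta_ky_k\bigr)}{\prod_{k=1}^{\ell}\bigl[\prod_{i=1}^{m}\mathrm{B}(\lambda_{i1}y_k,\lambda_{i2}y_k,\dotsc,\lambda_{in}y_k)\bigr]^{\theta_k}}\\ &\quad\times\frac{\prod_{j=1}^{n}\mathrm{B}\bigl(\lambda_{1j}\sum_{k=1}^{\ell}\theta_ky_k,\ \lambda_{2j}\sum_{k=1}^{\ell}\theta_ky_k,\ \dotsc,\ \lambda_{mj}\sum_{k=1}^{\ell}\theta_ky_k\bigr)}{\prod_{k=1}^{\ell}\bigl[\prod_{j=1}^{n}\mathrm{B}(\lambda_{1j}y_k,\lambda_{2j}y_k,\dotsc,\lambda_{mj}y_k)\bigr]^{\theta_k}}\\ &\ge\frac{\prod_{k=1}^{\ell}y_k^{(2mn-m-n)\theta_k}}{\bigl(\sum_{k=1}^{\ell}\theta_ky_k\bigr)^{2mn-m-n}}\prod_{i=1}^{m}\frac{\sum_{j=1}^{n}\lambda_{ij}}{\prod_{j=1}^{n}\lambda_{ij}}\prod_{j=1}^{n}\frac{\sum_{i=1}^{m}\lambda_{ij}}{\prod_{i=1}^{m}\lambda_{ij}}\prod_{k=1}^{\ell}\Biggl[\prod_{i=1}^{m}\frac{\prod_{j=1}^{n}\lambda_{ij}}{\sum_{j=1}^{n}\lambda_{ij}}\prod_{j=1}^{n}\frac{\prod_{i=1}^{m}\lambda_{ij}}{\sum_{i=1}^{m}\lambda_{ij}}\Biggr]^{\theta_k}.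 \end{aligned} $$
   Context: For positive real numbers $a_1,\dotsc,a_r$ ($r\in\mathbb{N}$), the multivariate beta function is $$ \mathrm{B}(a_1,a_2,\dotsc,a_r)=\frac{\Gamma(a_1)\Gamma(a_2)\dotsm\Gamma(a_r)}{\Gamma(a_1+a_2+\dotsm+a_r)}, $$ where $\Gamma$ is the classical Euler gamma function (so $\mathrm{B}(a_1)=1$ when $r=1$). *)

theory Defs
  imports "HOL-Analysis.Gamma_Function"
begin

text \<open>The multivariate beta function of \<open>a 1, \<dots>, a r\<close>; only used for \<open>r \<ge> 1\<close> and
  positive arguments.\<close>

definition multi_Beta :: "nat \<Rightarrow> (nat \<Rightarrow> real) \<Rightarrow> real" where
  "multi_Beta r a = (\<Prod>i=1..r. Gamma (a i)) / Gamma (\<Sum>i=1..r. a i)"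

end

theory Submission
  imports Defs "HOL-Real_Asymp.Real_Asymp"
begin

text \<open>
  Replacing every \<open>\<Gamma>(a t)\<close> by \<open>\<Gamma>(1 + a t) / (a t)\<close> turns
  \<open>B(a\<^sub>1 t, \<dots>, a\<^sub>r t)\<close> into
  \<open>exp (\<rho> t) t\<^sup>1\<^sup>-\<^sup>r \<Sum>a / \<Prod>a\<close>, where
  \<open>\<rho> t = (\<Sum>j. ln \<Gamma>(1 + a\<^sub>j t)) - ln \<Gamma>(1 + t \<Sum>a)\<close>
  (\<open>multi_Beta_scaled_eq\<close>). The right-hand side of the theorem collects exactly the powers of the
  scaling parameter and the constants \<open>\<Sum>a / \<Prod>a\<close> that this produces over all rows and
  columns, the total exponent being \<open>m (1 - n) + n (1 - m) = -(2mn - m - n)\<close>. What is left is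
  Jensen's inequality for the sum of all the functions \<open>\<rho>\<close>, so the theorem amounts to
  the concavity of a single \<open>\<rho>\<close> (\<open>concave_on_ln_beta_core\<close>).

  With \<open>\<psi>'\<close> the trigamma function and \<open>S = \<Sum>a\<close>, the condition \<open>\<rho>'' \<le> 0\<close> reads
  \<open>\<Sum>j. a\<^sub>j\<^sup>2 \<psi>'(1 + a\<^sub>j t) \<le> S\<^sup>2 \<psi>'(1 + S t)\<close>. It holds because
  \<open>x \<psi>'(1 + x)\<close> is nondecreasing: this gives
  \<open>a\<^sub>j \<psi>'(1 + a\<^sub>j t) \<le> S \<psi>'(1 + S t)\<close>, and one multiplies by \<open>a\<^sub>j\<close> and sums. The monotonicity in turn
  is a termwise comparison of the series of its derivative with a telescoping series of sum zero
  (\<open>trigamma_monotonicity_deriv_nonneg\<close>).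
\<close>

section \<open>Monotonicity of the weighted trigamma function\<close>

text \<open>
  The derivative is \<open>\<Sum>k. 1/s\<^sup>2 - 2x/s\<^sup>3\<close> with \<open>s = 1 + x + k\<close>, whose terms change
  sign. But \<open>1/s\<^sup>2 \<ge> 1/s - 1/(s+1)\<close> and
  \<open>2/s\<^sup>3 \<le> 1/(s(s-1)) - 1/(s(s+1))\<close>, so each term is at least \<open>f k - f (k+1)\<close> for
  \<open>f k = 1/s - x/(s(s-1)) = k/((x+k)(1+x+k))\<close>. As \<open>f\<close> vanishes both at \<open>0\<close> and at infinity,
  these lower bounds sum to zero.
\<close>

lemma trigamma_monotonicity_deriv_nonneg:
  fixes x :: real
  assumes "x > 0"
  shows "Polygamma 1 (1 + x) + x * Polygamma 2 (1 + x) \<ge> 0"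
proof -
  define f where "f = (\<lambda>k. real k / ((x + real k) * (1 + x + real k)))"
  define g where "g = (\<lambda>k. inverse ((1 + x + real k) ^ 2) - 2 * x * inverse ((1 + x + real k) ^ 3))"
  have "(\<lambda>k. inverse ((1 + x + real k) ^ 2)) sums Polygamma 1 (1 + x)"
    using Polygamma_converges'[of "1 + x" 2] assms
    by (simp add: Polygamma_def summable_sums numeral_2_eq_2)
  moreover have "(\<lambda>k. - 2 * inverse ((1 + x + real k) ^ 3)) sums Polygamma 2 (1 + x)"
    using sums_mult[OF summable_sums[OF Polygamma_converges'[of "1 + x" 3]], of "- 2"] assms
    by (simp add: Polygamma_def numeral_3_eq_3 numeral_2_eq_2)
  ultimately have g_sums: "g sums (Polygamma 1 (1 + x) + x * Polygamma 2 (1 + x))"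
    unfolding g_def using sums_add sums_mult[of _ "Polygamma 2 (1 + x)" x] by (force simp: mult_ac)
  have "f \<longlonglongrightarrow> 0"
    unfolding f_def by real_asymp
  then have f_sums: "(\<lambda>k. f k - f (Suc k)) sums 0"
    using telescope_sums'[of f 0] by (simp add: f_def)
  have "f k - f (Suc k) \<le> g k" for k
  proof -
    define s where "s = 1 + x + real k"
    have s: "s > 1" "s - 1 > 0" and k: "real k = s - 1 - x"
      using assms by (auto simp: s_def)
    have f_eq: "f k = 1 / s - x * (1 / (s * (s - 1)))"
      unfolding f_def using s by (simp add: k divide_simps)
    have fSuc_eq: "f (Suc k) = 1 / (s + 1) - x * (1 / (s * (s + 1)))"
      unfolding f_def using s by (simp add: k divide_simps)
    have "1 / s - 1 / (s + 1) \<le> 1 / s ^ 2"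
    proof -
      have "1 / s - 1 / (s + 1) = 1 / (s * (s + 1))"
        using s by (simp add: divide_simps)
      also have "\<dots> \<le> 1 / s ^ 2"
        using s by (intro frac_le) (auto simp: power2_eq_square)
      finally show ?thesis .
    qed
    moreover have "2 / s ^ 3 \<le> 1 / (s * (s - 1)) - 1 / (s * (s + 1))"
    proof -
      have "1 / (s * (s - 1)) - 1 / (s * (s + 1)) = 2 / (s ^ 3 - s)"
      proof -
        have "s ^ 3 - s = s * (s - 1) * (s + 1)"
          by (simp add: power3_eq_cube algebra_simps)
        then show ?thesis
          using s by (simp add: divide_simps)
      qed
      moreover have "s ^ 3 - s > 0"
        using s power_strict_increasing[of 1 3 s] by simp
      ultimately show ?thesis
        using s by (simp add: frac_le)
    qed
    then have "x * (2 / s ^ 3) \<le> x * (1 / (s * (s - 1)) - 1 / (s * (s + 1)))"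
      using assms by (intro mult_left_mono) auto
    ultimately show ?thesis
      unfolding f_eq fSuc_eq by (simp add: g_def flip: s_def) (simp add: field_simps)
  qed
  then show ?thesis
    using sums_le[OF _ f_sums g_sums] by simp
qed

lemma weighted_trigamma_mono:
  fixes x y :: real
  assumes "0 < x" and "x \<le> y"
  shows "x * Polygamma 1 (1 + x) \<le> y * Polygamma 1 (1 + y)"
proof (rule DERIV_nonneg_imp_nondecreasing[OF \<open>x \<le> y\<close>])
  fix z assume "x \<le> z" "z \<le> y"
  with \<open>0 < x\<close> have z: "z > 0" "1 + z \<notin> \<int>\<^sub>\<le>\<^sub>0"
    by (auto simp: nonpos_Ints_def)
  have "((\<lambda>z. z * Polygamma 1 (1 + z)) has_real_derivative
      Polygamma 1 (1 + z) + z * Polygamma 2 (1 + z)) (at z)"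
    by (auto intro!: derivative_eq_intros simp: z numeral_2_eq_2)
  then show "\<exists>D. ((\<lambda>z. z * Polygamma 1 (1 + z)) has_real_derivative D) (at z) \<and> D \<ge> 0"
    using trigamma_monotonicity_deriv_nonneg[OF z(1)] by blast
qed

lemma sum_trigamma_le:
  fixes a :: "'a \<Rightarrow> real"
  assumes "finite A" and pos: "\<And>j. j \<in> A \<Longrightarrow> a j > 0" and "t > 0"
  shows "(\<Sum>j\<in>A. (a j)\<^sup>2 * Polygamma 1 (1 + a j * t)) \<le> (sum a A)\<^sup>2 * Polygamma 1 (1 + sum a A * t)"
proof -
  define S where "S = sum a A"
  have bound: "a j * Polygamma 1 (1 + a j * t) \<le> S * Polygamma 1 (1 + S * t)" if "j \<in> A" for j
  proof -
    have "a j \<le> S"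
      unfolding S_def using that assms by (intro member_le_sum) (auto intro: less_imp_le)
    then have "(a j * t) * Polygamma 1 (1 + a j * t) \<le> (S * t) * Polygamma 1 (1 + S * t)"
      using that pos \<open>t > 0\<close> by (intro weighted_trigamma_mono) auto
    then have "(a j * Polygamma 1 (1 + a j * t)) * t \<le> (S * Polygamma 1 (1 + S * t)) * t"
      by (simp add: mult_ac)
    with \<open>t > 0\<close> show ?thesis
      by (simp only: mult_le_cancel_right_pos)
  qed
  have "(\<Sum>j\<in>A. (a j)\<^sup>2 * Polygamma 1 (1 + a j * t)) = (\<Sum>j\<in>A. a j * (a j * Polygamma 1 (1 + a j * t)))"
    by (simp add: power2_eq_square mult_ac)
  also have "\<dots> \<le> (\<Sum>j\<in>A. a j * (S * Polygamma 1 (1 + S * t)))"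
    using bound pos by (intro sum_mono mult_left_mono) (auto intro: less_imp_le)
  also have "\<dots> = S\<^sup>2 * Polygamma 1 (1 + S * t)"
    by (simp add: S_def power2_eq_square sum_distrib_right mult_ac)
  finally show ?thesis
    by (simp only: S_def)
qed

section \<open>Concavity of the logarithmic core of the beta function\<close>

definition ln_beta_core :: "'a set \<Rightarrow> ('a \<Rightarrow> real) \<Rightarrow> real \<Rightarrow> real" where
  "ln_beta_core A a t = (\<Sum>j\<in>A. ln_Gamma (1 + a j * t)) - ln_Gamma (1 + sum a A * t)"

lemma concave_on_ln_beta_core:
  fixes a :: "'a \<Rightarrow> real"
  assumes "finite A" and pos: "\<And>j. j \<in> A \<Longrightarrow> a j > 0"
  shows "concave_on {0<..} (ln_beta_core A a)"
proof (rule f''_le0_imp_concave)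
  define S where "S = sum a A"
  have S: "S \<ge> 0"
    unfolding S_def using pos by (intro sum_nonneg) (auto intro: less_imp_le)
  fix t :: real assume "t \<in> {0<..}"
  then have t: "t > 0" by simp
  have arg: "1 + c * t > 0" "1 + c * t \<notin> \<int>\<^sub>\<le>\<^sub>0" if "c \<ge> 0" for c
  proof -
    have "c * t \<ge> 0"
      using that t by simp
    then show "1 + c * t > 0" "1 + c * t \<notin> \<int>\<^sub>\<le>\<^sub>0"
      by (auto simp: nonpos_Ints_def)
  qed
  have argS: "1 + S * t > 0" "1 + S * t \<notin> \<int>\<^sub>\<le>\<^sub>0"
    using arg[OF S] .
  have arga: "1 + a j * t > 0" "1 + a j * t \<notin> \<int>\<^sub>\<le>\<^sub>0" if "j \<in> A" for j
    using arg[of "a j"] pos[OF that] by auto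
  show "(ln_beta_core A a has_real_derivative
      (\<Sum>j\<in>A. a j * Digamma (1 + a j * t)) - sum a A * Digamma (1 + sum a A * t)) (at t)"
    unfolding ln_beta_core_def S_def[symmetric]
    by (auto intro!: derivative_eq_intros sum.cong simp: argS arga)
  show "((\<lambda>t. (\<Sum>j\<in>A. a j * Digamma (1 + a j * t)) - sum a A * Digamma (1 + sum a A * t))
      has_real_derivative
      (\<Sum>j\<in>A. (a j)\<^sup>2 * Polygamma 1 (1 + a j * t))
        - (sum a A)\<^sup>2 * Polygamma 1 (1 + sum a A * t)) (at t)"
    unfolding S_def[symmetric]
    by (auto intro!: derivative_eq_intros sum.cong simp: argS arga power2_eq_square)
  show "(\<Sum>j\<in>A. (a j)\<^sup>2 * Polygamma 1 (1 + a j * t))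
      - (sum a A)\<^sup>2 * Polygamma 1 (1 + sum a A * t) \<le> 0"
    using sum_trigamma_le[OF assms t] by simp
qed simp

lemma concave_on_finite_sum:
  fixes f :: "'i \<Rightarrow> 'a::real_vector \<Rightarrow> real"
  assumes "finite I" and "convex C" and "\<And>i. i \<in> I \<Longrightarrow> concave_on C (f i)"
  shows "concave_on C (\<lambda>x. \<Sum>i\<in>I. f i x)"
  using assms by (induction I rule: finite_induct) (auto intro: concave_on_add simp: concave_on_const)

lemma multi_Beta_scaled_eq:
  assumes "r \<ge> 1" and pos: "\<And>j. j \<in> {1..r} \<Longrightarrow> a j > 0" and "t > 0"
  shows "multi_Beta r (\<lambda>j. a j * t) =
    exp (ln_beta_core {1..r} a t) * t powr (1 - real r) * ((\<Sum>j=1..r. a j) / (\<Prod>j=1..r. a j))"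
proof -
  define S where "S = (\<Sum>j=1..r. a j)"
  have "S > 0"
    unfolding S_def using \<open>r \<ge> 1\<close> pos by (intro sum_pos) auto
  have Gamma_eq: "Gamma (c * t) = exp (ln_Gamma (1 + c * t)) / (c * t)" if "c > 0" for c
  proof -
    have ct: "c * t > 0"
      using that \<open>t > 0\<close> by simp
    then have "c * t \<notin> \<int>\<^sub>\<le>\<^sub>0"
      by (auto simp: nonpos_Ints_def)
    then have "Gamma (c * t + 1) = c * t * Gamma (c * t)"
      by (rule Gamma_plus1)
    moreover have "Gamma (c * t + 1) = exp (ln_Gamma (1 + c * t))"
      using ct by (simp add: Gamma_real_pos_exp add.commute)
    ultimately show ?thesis
      using ct by (metis less_irrefl nonzero_mult_div_cancel_left)
  qed
  have prod: "(\<Prod>j=1..r. Gamma (a j * t)) =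
      exp (\<Sum>j=1..r. ln_Gamma (1 + a j * t)) / ((\<Prod>j=1..r. a j) * t ^ r)"
  proof -
    have "(\<Prod>j=1..r. Gamma (a j * t)) = (\<Prod>j=1..r. exp (ln_Gamma (1 + a j * t)) / (a j * t))"
      using pos by (intro prod.cong) (auto simp: Gamma_eq)
    then show ?thesis
      by (simp add: prod_dividef prod.distrib exp_sum)
  qed
  have sum_eq: "(\<Sum>j=1..r. a j * t) = S * t"
    by (simp add: S_def sum_distrib_right)
  have "t powr (1 - real r) = t / t ^ r"
    using \<open>t > 0\<close> by (simp add: powr_diff powr_realpow)
  then show ?thesis
    unfolding multi_Beta_def sum_eq prod Gamma_eq[OF \<open>S > 0\<close>] ln_beta_core_def exp_diff S_def[symmetric]
    by (simp add: mult_ac)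
qed

lemma prod_multi_Beta_scaled_eq:
  assumes "r \<ge> 1" and "\<And>i j. i \<in> {1..p} \<Longrightarrow> j \<in> {1..r} \<Longrightarrow> a i j > 0" and "t > 0"
  shows "(\<Prod>i=1..p. multi_Beta r (\<lambda>j. a i j * t)) =
    exp (\<Sum>i=1..p. ln_beta_core {1..r} (a i) t) * t powr (real p * (1 - real r))
      * (\<Prod>i=1..p. (\<Sum>j=1..r. a i j) / (\<Prod>j=1..r. a i j))"
proof -
  have prod_eq: "(\<Prod>i=1..p. multi_Beta r (\<lambda>j. a i j * t)) =
    (\<Prod>i=1..p. exp (ln_beta_core {1..r} (a i) t) * t powr (1 - real r)
      * ((\<Sum>j=1..r. a i j) / (\<Prod>j=1..r. a i j)))"
    using assms by (intro prod.cong refl multi_Beta_scaled_eq) auto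
  have powr_eq: "t powr (real p * (1 - real r)) = (\<Prod>i=1..p. t powr (1 - real r))"
    using \<open>t > 0\<close> by (simp add: powr_power mult.commute)
  show ?thesis
    unfolding prod_eq powr_eq exp_sum[OF finite_atLeastAtMost] prod.distrib ..
qed

section \<open>Jensen's inequality with a power factor\<close>

text \<open>
  Once the factor \<open>K t\<^sup>-\<^sup>N\<close> is taken out of \<open>F\<close>, this is Jensen's inequality for
  \<open>g\<close>. Since the weights sum to one, the factors involving \<open>K\<close> have product one; they are
  displayed because the inequality for matrices displays them.
\<close>

lemma jensen_exp_concave_power:
  fixes F g :: "real \<Rightarrow> real" and \<theta> y :: "'a \<Rightarrow> real"
  assumes "finite I" and "I \<noteq> {}" and \<theta>: "\<And>k. k \<in> I \<Longrightarrow> \<theta> k \<ge> 0" "sum \<theta> I = 1"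
    and y: "\<And>k. k \<in> I \<Longrightarrow> y k > 0"
    and concave: "concave_on {0<..} g" and "K > 0"
    and F: "\<And>t. t > 0 \<Longrightarrow> F t = exp (g t) * t powr (- N) * K"
  shows "F (\<Sum>k\<in>I. \<theta> k * y k) / (\<Prod>k\<in>I. F (y k) powr \<theta> k) \<ge>
    (\<Prod>k\<in>I. y k powr (N * \<theta> k)) / (\<Sum>k\<in>I. \<theta> k * y k) powr N * K * (\<Prod>k\<in>I. (1 / K) powr \<theta> k)"
proof -
  define Y where "Y = (\<Sum>k\<in>I. \<theta> k * y k)"
  have "Y \<in> {0<..}"
    unfolding Y_def using convex_sum[of I "{0::real<..}" \<theta> y] assms(1) \<theta> y by simp
  then have Y: "Y > 0" by simp
  have jensen: "(\<Sum>k\<in>I. \<theta> k * g (y k)) \<le> g Y"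
    using concave_on_sum[OF \<open>finite I\<close> \<open>I \<noteq> {}\<close> concave \<theta>(2), of y] \<theta>(1) y by (simp add: Y_def)
  have F_powr: "F (y k) powr \<theta> k =
      exp (\<theta> k * g (y k)) / (y k powr (N * \<theta> k) * (1 / K) powr \<theta> k)" if "k \<in> I" for k
    using y[OF that] \<open>K > 0\<close>
    by (simp add: F powr_mult powr_powr powr_minus powr_divide exp_powr_real field_simps)
  have denom: "(\<Prod>k\<in>I. F (y k) powr \<theta> k) = exp (\<Sum>k\<in>I. \<theta> k * g (y k)) /
      ((\<Prod>k\<in>I. y k powr (N * \<theta> k)) * (\<Prod>k\<in>I. (1 / K) powr \<theta> k))"
    using \<open>finite I\<close> by (simp add: F_powr prod_dividef prod.distrib exp_sum cong: prod.cong)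
  define P where "P = (\<Prod>k\<in>I. y k powr (N * \<theta> k)) / Y powr N * K * (\<Prod>k\<in>I. (1 / K) powr \<theta> k)"
  have "P \<ge> 0"
    unfolding P_def using \<open>K > 0\<close> by (intro mult_nonneg_nonneg divide_nonneg_nonneg prod_nonneg) auto
  then have "P * 1 \<le> P * exp (g Y - (\<Sum>k\<in>I. \<theta> k * g (y k)))"
    using jensen by (intro mult_left_mono) auto
  also have "\<dots> = F Y / (\<Prod>k\<in>I. F (y k) powr \<theta> k)"
    unfolding denom F[OF Y] P_def by (simp add: exp_diff powr_minus divide_simps)
  finally show ?thesis
    by (simp add: P_def Y_def)
qed

section \<open>The inequality for matrices\<close>

theorem mainTheorem4:
  fixes m n l :: nat
    and \<theta> y :: "nat \<Rightarrow> real"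
    and \<Lambda> :: "nat \<Rightarrow> nat \<Rightarrow> real"
  assumes "m \<ge> 1" and "n \<ge> 1" and "l \<ge> 1"
    and "\<And>k. k \<in> {1..l} \<Longrightarrow> 0 < \<theta> k \<and> \<theta> k < 1"
    and "(\<Sum>k=1..l. \<theta> k) = 1"
    and "\<And>k. k \<in> {1..l} \<Longrightarrow> y k > 0"
    and "\<And>i j. i \<in> {1..m} \<Longrightarrow> j \<in> {1..n} \<Longrightarrow> \<Lambda> i j > 0"
  shows
    "((\<Prod>i=1..m. multi_Beta n (\<lambda>j. \<Lambda> i j * (\<Sum>k=1..l. \<theta> k * y k)))
        / (\<Prod>k=1..l. (\<Prod>i=1..m. multi_Beta n (\<lambda>j. \<Lambda> i j * y k)) powr \<theta> k))
     * ((\<Prod>j=1..n. multi_Beta m (\<lambda>i. \<Lambda> i j * (\<Sum>k=1..l. \<theta> k * y k)))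
        / (\<Prod>k=1..l. (\<Prod>j=1..n. multi_Beta m (\<lambda>i. \<Lambda> i j * y k)) powr \<theta> k))
     \<ge> ((\<Prod>k=1..l. y k powr ((2 * real m * real n - real m - real n) * \<theta> k))
          / (\<Sum>k=1..l. \<theta> k * y k) powr (2 * real m * real n - real m - real n))
       * (\<Prod>i=1..m. (\<Sum>j=1..n. \<Lambda> i j) / (\<Prod>j=1..n. \<Lambda> i j))
       * (\<Prod>j=1..n. (\<Sum>i=1..m. \<Lambda> i j) / (\<Prod>i=1..m. \<Lambda> i j))
       * (\<Prod>k=1..l. ((\<Prod>i=1..m. (\<Prod>j=1..n. \<Lambda> i j) / (\<Sum>j=1..n. \<Lambda> i j))
                    * (\<Prod>j=1..n. (\<Prod>i=1..m. \<Lambda> i j) / (\<Sum>i=1..m. \<Lambda> i j))) powr \<theta> k)"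
proof -
  define N where "N = 2 * real m * real n - real m - real n"
  define rows where "rows t = (\<Prod>i=1..m. multi_Beta n (\<lambda>j. \<Lambda> i j * t))" for t
  define cols where "cols t = (\<Prod>j=1..n. multi_Beta m (\<lambda>i. \<Lambda> i j * t))" for t
  define Kr where "Kr = (\<Prod>i=1..m. (\<Sum>j=1..n. \<Lambda> i j) / (\<Prod>j=1..n. \<Lambda> i j))"
  define Kc where "Kc = (\<Prod>j=1..n. (\<Sum>i=1..m. \<Lambda> i j) / (\<Prod>i=1..m. \<Lambda> i j))"
  define g where "g t = (\<Sum>i=1..m. ln_beta_core {1..n} (\<Lambda> i) t)
    + (\<Sum>j=1..n. ln_beta_core {1..m} (\<lambda>i. \<Lambda> i j) t)" for t
  have "concave_on {0<..} g"
    unfolding g_def using assms(7)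
    by (intro concave_on_add concave_on_finite_sum concave_on_ln_beta_core) auto
  moreover have "Kr > 0" "Kc > 0"
    unfolding Kr_def Kc_def using assms(1,2,7) by (auto intro!: prod_pos divide_pos_pos sum_pos)
  moreover have "rows t * cols t = exp (g t) * t powr (- N) * (Kr * Kc)" if "t > 0" for t
  proof -
    have "rows t = exp (\<Sum>i=1..m. ln_beta_core {1..n} (\<Lambda> i) t) * t powr (real m * (1 - real n)) * Kr"
      unfolding rows_def Kr_def using assms that by (intro prod_multi_Beta_scaled_eq) auto
    moreover have "cols t = exp (\<Sum>j=1..n. ln_beta_core {1..m} (\<lambda>i. \<Lambda> i j) t)
        * t powr (real n * (1 - real m)) * Kc"
      unfolding cols_def Kc_def using assms that by (intro prod_multi_Beta_scaled_eq) auto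
    moreover have "- N = real m * (1 - real n) + real n * (1 - real m)"
      by (simp add: N_def algebra_simps)
    ultimately show ?thesis
      by (simp add: g_def exp_add powr_add mult_ac)
  qed
  ultimately have "rows (\<Sum>k=1..l. \<theta> k * y k) * cols (\<Sum>k=1..l. \<theta> k * y k)
        / (\<Prod>k=1..l. (rows (y k) * cols (y k)) powr \<theta> k)
      \<ge> (\<Prod>k=1..l. y k powr (N * \<theta> k)) / (\<Sum>k=1..l. \<theta> k * y k) powr N
        * (Kr * Kc) * (\<Prod>k=1..l. (1 / (Kr * Kc)) powr \<theta> k)"
    using assms(3-6) by (intro jensen_exp_concave_power[where g = g]) (auto simp: less_imp_le)
  moreover have "(rows t * cols t) powr p = rows t powr p * cols t powr p" if "t > 0" for t p
  proof -
    have "rows t > 0" "cols t > 0"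
      unfolding rows_def cols_def multi_Beta_def using assms(1,2,7) that
      by (auto intro!: prod_pos divide_pos_pos Gamma_real_pos sum_pos)
    then show ?thesis
      by (simp add: powr_mult)
  qed
  then have "(\<Prod>k=1..l. (rows (y k) * cols (y k)) powr \<theta> k)
      = (\<Prod>k=1..l. rows (y k) powr \<theta> k) * (\<Prod>k=1..l. cols (y k) powr \<theta> k)"
    using assms(6) by (simp flip: prod.distrib)
  moreover have "1 / (Kr * Kc) = (\<Prod>i=1..m. (\<Prod>j=1..n. \<Lambda> i j) / (\<Sum>j=1..n. \<Lambda> i j))
      * (\<Prod>j=1..n. (\<Prod>i=1..m. \<Lambda> i j) / (\<Sum>i=1..m. \<Lambda> i j))"
    by (simp add: Kr_def Kc_def prod_dividef)
  ultimately show ?thesis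
    unfolding rows_def cols_def N_def Kr_def Kc_def by (simp only: times_divide_times_eq mult.assoc)
qed

end
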